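(* Let $\mathbf{D}_{prior}\in\mathbb{C}^{N\times N}$ satisfy $\mathbf{D}_{prior}^H\mathbf{D}_{prior}=\mathbf{I}$, let $\mathbf{r}_1,\dots,\mathbf{r}_K\in\mathbb{C}^{N\times1}$ be linearly independent, $\mathbf{R}=(\mathbf{r}_1,\dots,\mathbf{r}_K)\in\mathbb{C}^{N\times K}$, and let $\mathbf{D}_{post}=\mathbf{D}_{prior}\mathbf{H}_1\cdots\mathbf{H}_K$ be the HOT posterior transform domain with multiple reference knowledge $\mathbf{r}_1,\dots,\mathbf{r}_K$ and indices $j_1,\dots,j_K$ (defined in the context). Let $\mathbf{x}\in\mathbb{C}^{N\times1}$ be a nonzero vector (the true signal) with representations $\mathbf{w}_{prior}$, $\mathbf{w}_{post}$ in the two domains, i.e. $$\mathbf{x}=\mathbf{D}_{prior}\mathbf{w}_{prior}=\mathbf{D}_{post}\mathbf{w}_{post},$$ and let $$\rho=\frac{\|\mathbf{R}(\mathbf{R}^H\mathbf{R})^{-1}\mathbf{R}^H\mathbf{x}\|_2}{\|\mathbf{x}\|_2}\in[0,1].$$ (a) If $\rho\ge\sqrt{\gamma_K(\mathbf{w}_{prior})}$, then $\gamma_K(\mathbf{w}_{post})\ge\gamma_K(\mathbf{w}_{prior})$. (b) Let $\mathbf{w}_i=\mathbf{D}_{prior}^H\mathbf{r}_i$ for $i=1,\dots,K$. If $\operatorname{supp}(\mathbf{w}_i)\subseteq\operatorname{supp}(\mathbf{w}_{prior})$ and $\mathbf{r}_i^H\mathbf{D}_{prior,j_i}\ne0$ for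 all $i=1,\dots,K$, then $\|\mathbf{w}_{post}\|_0\le\|\mathbf{w}_{prior}\|_0$. (c) Suppose $\|\mathbf{w}_{prior}\|_0\ge K$, and define $$odd=\frac{\|\mathbf{w}_{prior}\|_1}{\|\mathbf{w}_{prior}\|_2},\qquad\text{where }\sqrt{K}\le odd\le\sqrt{N}.$$ Then $\|\mathbf{w}_{post}\|_1\le\|\mathbf{w}_{prior}\|_1$ holds in each of the following cases: (i) $\sqrt{K}\le odd\le\sqrt{N-K}$ and $$\rho\ge\frac{\sqrt{K}\,odd+\sqrt{(N-K)(N-odd^2)}}{N};$$ (ii) $\sqrt{N-K}\le odd\le\sqrt{N}$ and $$\rho\ge\frac{\sqrt{K}\,odd+\sqrt{(N-K)(N-odd^2)}}{N}\quad\text{or}\quad\rho\le\frac{\sqrt{K}\,odd-\sqrt{(N-K)(N-odd^2)}}{N}.$$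
   Context: $(\cdot)^H$ denotes conjugate transpose, $\mathbf{e}_j$ is the $j$-th standard basis vector, $\mathbf{D}_{prior,j}$ is the $j$-th column of $\mathbf{D}_{prior}$, $\|\cdot\|_0$ is the number of nonzero entries, $\operatorname{supp}$ is the set of indices of nonzero entries, and $\|\cdot\|_1,\|\cdot\|_2$ are the $\ell_1$ and $\ell_2$ norms on $\mathbb{C}^N$. $K$-energy concentration of a nonzero $\mathbf{a}\in\mathbb{C}^N$: $\gamma_K(\mathbf{a})=\dfrac{\sum_{i=1}^K|a_{(i)}|^2}{\|\mathbf{a}\|_2^2}$, where $|a_{(1)}|\ge|a_{(2)}|\ge\cdots\ge|a_{(N)}|$ are the entries of $\mathbf{a}$ ordered by descending magnitude. The range $\sqrt{K}\le odd\le\sqrt{N}$ in (c) is an assumption on $\mathbf{w}_{prior}$. HOT with multiple reference knowledge: let $\Omega=\{1,\dots,N\}$; for $\mathbf{a}\in\mathbb{C}^N$ and $S\subseteq\Omega$, $\mathbf{a}_S\in\mathbb{C}^N$ agrees with $\mathbf{a}$ on the coordinates in $S$ and is zero elsewhere. Put $\mathbf{w}_i=\mathbf{D}_{prior}^H\mathbf{r}_i$. Choose distinct indices $j_1,\dots,j_K\in\Omega$. For $i=1,\dots,K$ in turn, put $\mathbf{u}_i=\mathbf{H}_{i-1}\cdots\mathbf{H}_1\mathbf{w}_i$ (with $\mathbf{u}_1=\mathbf{w}_1$) and $S_i=\Omega\setminus\{j_1,\dots,j_{i-1}\}$, let $\alpha_i\in\mathbb{C}$ satisfy $|\alpha_i|=\|(\mathbf{u}_i)_{S_i}\|_2$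 and $\alpha_i\mathbf{u}_i^H\mathbf{e}_{j_i}\in\mathbb{R}$, and set $$\mathbf{v}_i=\frac{(\mathbf{u}_i-\alpha_i\mathbf{e}_{j_i})_{S_i}}{\|(\mathbf{u}_i-\alpha_i\mathbf{e}_{j_i})_{S_i}\|_2},\qquad\mathbf{H}_i=\mathbf{I}-2\mathbf{v}_i\mathbf{v}_i^H$$ (with $\mathbf{H}_i=\mathbf{I}$ if $(\mathbf{u}_i-\alpha_i\mathbf{e}_{j_i})_{S_i}=\mathbf{0}$). Then $\mathbf{D}_{post}=\mathbf{D}_{prior}\mathbf{H}_1\cdots\mathbf{H}_K$. *)

theory Defs
  imports
    Complex_Main
    "Jordan_Normal_Form.Gauss_Jordan_Elimination"
    "Jordan_Normal_Form.Schur_Decomposition"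
    "Jordan_Normal_Form.VS_Connect"
begin

text \<open>Coordinates of \<open>complex vec\<close> and positions in lists are counted from 0, so the
  coordinate set is \<open>{0..<N}\<close> and the i-th reference vector is \<open>rs ! i\<close> with \<open>i < K\<close>.\<close>

definition vec_supp :: "complex vec \<Rightarrow> nat set" where
  "vec_supp a = {i. i < dim_vec a \<and> a $ i \<noteq> 0}"

definition l0_norm :: "complex vec \<Rightarrow> nat" where
  "l0_norm a = card (vec_supp a)"

definition l1_norm :: "complex vec \<Rightarrow> real" where
  "l1_norm a = (\<Sum>i<dim_vec a. cmod (a $ i))"

definition l2_norm :: "complex vec \<Rightarrow> real" where
  "l2_norm a = sqrt (\<Sum>i<dim_vec a. (cmod (a $ i))\<^sup>2)"

definition magnitudes_desc :: "complex vec \<Rightarrow> real list" where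
  "magnitudes_desc a = rev (sort (map cmod (list_of_vec a)))"

definition energy_concentration :: "nat \<Rightarrow> complex vec \<Rightarrow> real" where
  "energy_concentration K a = (\<Sum>i<K. (magnitudes_desc a ! i)\<^sup>2) / (l2_norm a)\<^sup>2"

definition vec_restrict :: "nat set \<Rightarrow> complex vec \<Rightarrow> complex vec" where
  "vec_restrict S a = vec (dim_vec a) (\<lambda>i. if i \<in> S then a $ i else 0)"

definition lin_indpt_vecs :: "nat \<Rightarrow> complex vec list \<Rightarrow> bool" where
  "lin_indpt_vecs N rs \<longleftrightarrow> set rs \<subseteq> carrier_vec N \<and> distinct rs \<and>
     \<not> module.lin_dep class_ring (module_vec TYPE(complex) N) (set rs)"

text \<open>\<open>mat_inverse\<close> returns \<open>None\<close> exactly on non-invertible matrices, so \<open>the\<close> below is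
  meaningful because the Gram matrix of linearly independent columns is invertible.\<close>

definition column_projection :: "complex mat \<Rightarrow> complex mat" where
  "column_projection R = R * the (mat_inverse (mat_adjoint R * R)) * mat_adjoint R"

definition householder :: "complex vec \<Rightarrow> complex mat" where
  "householder v = (let V = mat_of_cols (dim_vec v) [v]
     in 1\<^sub>m (dim_vec v) - 2 \<cdot>\<^sub>m (V * mat_adjoint V))"

definition hot_reflection :: "nat set \<Rightarrow> nat \<Rightarrow> complex \<Rightarrow> complex vec \<Rightarrow> complex mat" where
  "hot_reflection S j \<alpha> u =
     (let d = vec_restrict S (u - \<alpha> \<cdot>\<^sub>v unit_vec (dim_vec u) j)
      in if d = 0\<^sub>v (dim_vec u) then 1\<^sub>m (dim_vec u)
         else householder (complex_of_real (1 / l2_norm d) \<cdot>\<^sub>v d))"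

text \<open>The conditions fix \<open>\<alpha> i\<close> only up to sign (up to phase if entry \<open>js ! i\<close> of \<open>u\<close> is 0), so the
  posterior domain is a relation: \<open>D'\<close> arises from some admissible choice of them.
  The \<open>fold\<close> applies \<open>H 0\<close> first, giving \<open>H (i-1) \<cdots> H 0 w\<close>, whereas \<open>foldl\<close> gives
  \<open>D H 0 \<cdots> H (K-1)\<close>. Note that \<open>x \<bullet>c y\<close> conjugates \<open>y\<close>, i.e. it is \<open>y\<^sup>H x\<close>.\<close>

definition hot_posterior ::
  "nat \<Rightarrow> complex mat \<Rightarrow> complex vec list \<Rightarrow> nat list \<Rightarrow> complex mat \<Rightarrow> bool" where
  "hot_posterior N D rs js D' \<longleftrightarrow>
     length js = length rs \<and> distinct js \<and> set js \<subseteq> {0..<N} \<and>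
     (\<exists>\<alpha> H.
        (\<forall>i<length rs.
           let u = fold (\<lambda>k y. H k *\<^sub>v y) [0..<i] (mat_adjoint D *\<^sub>v (rs ! i));
               S = {0..<N} - set (take i js)
           in cmod (\<alpha> i) = l2_norm (vec_restrict S u) \<and>
              \<alpha> i * (unit_vec N (js ! i) \<bullet>c u) \<in> \<real> \<and>
              H i = hot_reflection S (js ! i) (\<alpha> i) u) \<and>
        D' = foldl (*) D (map H [0..<length rs]))"

end

theory Submission
  imports Defs "Jordan_Normal_Form.DL_Rank" "HOL-Analysis.L2_Norm"
begin

text \<open>The posterior domain \<open>U\<close> is the prior domain followed by Householder reflections, so it is
  again unitary and \<open>wpost\<close> is \<open>U\<^sup>H x\<close>. The reflection number \<open>i\<close> is built so that it
  sends the current image of the \<open>i\<close>-th reference vector to a vector supported on the first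
  \<open>i + 1\<close> chosen coordinates, and the later reflections fix all such vectors because they act
  only on the other coordinates. Hence every \<open>U\<^sup>H r\<close>, for a reference vector \<open>r\<close>, is
  supported on the set \<open>J\<close> of the \<open>K\<close> chosen coordinates
  (\<open>vec_supp_hot_posterior_reference\<close>). Since the \<open>K\<close> reference vectors are independent,
  \<open>U\<^sup>H\<close> maps their span onto the full coordinate subspace of \<open>J\<close>, and the orthogonal projection
  onto the span becomes restriction to \<open>J\<close> (\<open>l2_norm_column_projection\<close>). So \<open>\<rho>\<^sup>2\<close> is
  precisely the fraction of the energy of \<open>wpost\<close> that sits on \<open>J\<close>. The three claims follow.

  For the concentration claim, the \<open>K\<close> largest entries of \<open>wpost\<close> carry at least the energy on
  \<open>J\<close>, so its concentration is at least \<open>\<rho>\<^sup>2\<close>.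

  For the sparsity claim, a reflection built from a vector supported on \<open>W\<close> and an index in \<open>W\<close>
  preserves the vectors supported on \<open>W\<close>; this is applied to the support \<open>W\<close> of \<open>wprior\<close>, which
  contains \<open>J\<close> because the entry of \<open>Dprior\<^sup>H r\<close> at the chosen index is nonzero.

  For the \<open>l\<^sub>1\<close> claim, Cauchy-Schwarz on \<open>J\<close> and on its complement bounds the \<open>l\<^sub>1\<close> norm of
  \<open>wpost\<close>, in units of its \<open>l\<^sub>2\<close> norm, by \<open>sqrt K * \<rho> + sqrt (N - K) * sqrt (1 - \<rho>\<^sup>2)\<close>. This
  is a concave function of \<open>\<rho>\<close>, and the \<open>\<rho>\<close> at which it exceeds \<open>od\<close> lie strictly between the
  two thresholds, which solve the quadratic equation obtained by setting it equal to \<open>od\<close>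
  (\<open>inner_unit_le_if_outside_thresholds\<close>).\<close>

section \<open>Adjoints, norms and isometries\<close>

lemma mat_adjoint_carrier:
  "A \<in> carrier_mat m n \<Longrightarrow> mat_adjoint A \<in> carrier_mat n m"
  by (auto simp: mat_adjoint_def)

lemma dim_mat_adjoint [simp]:
  "dim_row (mat_adjoint A) = dim_col A" "dim_col (mat_adjoint A) = dim_row A"
  by (auto simp: mat_adjoint_def)

lemma index_mat_adjoint:
  fixes A :: "complex mat"
  assumes "A \<in> carrier_mat m n" "i < n" "j < m"
  shows "mat_adjoint A $$ (i, j) = cnj (A $$ (j, i))"
  using assms by (auto simp: mat_adjoint_def mat_of_rows_def)

lemma mat_adjoint_mult:
  fixes A B :: "complex mat"
  assumes A: "A \<in> carrier_mat m n" and B: "B \<in> carrier_mat n k"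
  shows "mat_adjoint (A * B) = mat_adjoint B * mat_adjoint A"
proof (rule eq_matI)
  note AB = mult_carrier_mat[OF A B]
  fix i j assume "i < dim_row (mat_adjoint B * mat_adjoint A)"
    "j < dim_col (mat_adjoint B * mat_adjoint A)"
  hence i: "i < k" and j: "j < m"
    using mat_adjoint_carrier[OF A] mat_adjoint_carrier[OF B] by auto
  show "mat_adjoint (A * B) $$ (i, j) = (mat_adjoint B * mat_adjoint A) $$ (i, j)"
    using A B AB i j
    by (simp add: index_mult_mat index_mat_adjoint[OF AB] scalar_prod_def index_mat_adjoint[OF A]
        index_mat_adjoint[OF B] mult.commute)
qed (use mat_adjoint_carrier[OF A] mat_adjoint_carrier[OF B]
      mat_adjoint_carrier[OF mult_carrier_mat[OF A B]] in auto)

lemma cscalar_prod_mat_adjoint: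
  fixes A :: "complex mat"
  assumes A: "A \<in> carrier_mat m n" and x: "x \<in> carrier_vec n" and y: "y \<in> carrier_vec m"
  shows "(A *\<^sub>v x) \<bullet>c y = x \<bullet>c (mat_adjoint A *\<^sub>v y)"
proof -
  have "(A *\<^sub>v x) \<bullet>c y = (\<Sum>i<m. \<Sum>j<n. A $$ (i, j) * x $ j * cnj (y $ i))"
    using A x y by (simp add: scalar_prod_def lessThan_atLeast0 sum_distrib_right)
  also have "\<dots> = (\<Sum>j<n. \<Sum>i<m. A $$ (i, j) * x $ j * cnj (y $ i))"
    by (rule sum.swap)
  also have "\<dots> = x \<bullet>c (mat_adjoint A *\<^sub>v y)"
    using A x y
    by (simp add: scalar_prod_def row_def lessThan_atLeast0 sum_distrib_left index_mat_adjoint[OF A] ac_simps)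
  finally show ?thesis .
qed

lemma l2_norm_L2_set: "l2_norm a = L2_set (\<lambda>i. cmod (a $ i)) {..<dim_vec a}"
  by (simp add: l2_norm_def L2_set_def)

lemma l2_norm_square: "complex_of_real ((l2_norm a)\<^sup>2) = a \<bullet>c a"
  by (simp add: l2_norm_def sum_nonneg scalar_prod_def lessThan_atLeast0
      flip: complex_norm_square)

lemma l2_norm_nonneg [simp]: "0 \<le> l2_norm a"
  by (simp add: l2_norm_L2_set)

lemma l2_norm_zero_iff:
  assumes "a \<in> carrier_vec n"
  shows "l2_norm a = 0 \<longleftrightarrow> a = 0\<^sub>v n"
proof -
  have "l2_norm a = 0 \<longleftrightarrow> complex_of_real ((l2_norm a)\<^sup>2) = 0" by simp
  thus ?thesis unfolding l2_norm_square using assms by simp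
qed

lemma l2_norm_isometry:
  assumes A: "A \<in> carrier_mat m n" and iso: "mat_adjoint A * A = 1\<^sub>m n"
    and x: "x \<in> carrier_vec n"
  shows "l2_norm (A *\<^sub>v x) = l2_norm x"
proof -
  have "(A *\<^sub>v x) \<bullet>c (A *\<^sub>v x) = x \<bullet>c (mat_adjoint A *\<^sub>v (A *\<^sub>v x))"
    using A x by (intro cscalar_prod_mat_adjoint) auto
  also have "mat_adjoint A *\<^sub>v (A *\<^sub>v x) = x"
    using assoc_mult_mat_vec[OF mat_adjoint_carrier[OF A] A x] iso x by simp
  finally have "(l2_norm (A *\<^sub>v x))\<^sup>2 = (l2_norm x)\<^sup>2"
    unfolding l2_norm_square[symmetric] of_real_eq_iff .
  thus ?thesis by (simp add: power2_eq_iff_nonneg)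
qed

section \<open>Householder reflections\<close>

lemma householder_carrier:
  "v \<in> carrier_vec n \<Longrightarrow> householder v \<in> carrier_mat n n"
  by (auto simp: householder_def Let_def)

lemma index_householder:
  assumes "v \<in> carrier_vec n" "i < n" "j < n"
  shows "householder v $$ (i, j) = (if i = j then 1 else 0) - 2 * (v $ i * cnj (v $ j))"
proof -
  have "mat_of_cols n [v] \<in> carrier_mat n 1" by auto
  note index_mat_adjoint[OF this]
  thus ?thesis using assms
    by (simp add: householder_def Let_def scalar_prod_def mat_of_cols_Cons_index_0)
qed

lemma mat_adjoint_householder:
  assumes "v \<in> carrier_vec n"
  shows "mat_adjoint (householder v) = householder v"
  using householder_carrier[OF assms] mat_adjoint_carrier[OF householder_carrier[OF assms]]
  by (intro eq_matI) (auto simp: index_mat_adjoint[OF householder_carrier[OF assms]]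
      index_householder[OF assms])

lemma householder_mult_vec:
  assumes v: "v \<in> carrier_vec n" and y: "y \<in> carrier_vec n"
  shows "householder v *\<^sub>v y = y - (2 * (y \<bullet>c v)) \<cdot>\<^sub>v v"
proof (rule eq_vecI)
  fix i assume "i < dim_vec (y - (2 * (y \<bullet>c v)) \<cdot>\<^sub>v v)"
  hence i: "i < n" using v by simp
  have "(householder v *\<^sub>v y) $ i
      = (\<Sum>j<n. ((if i = j then 1 else 0) - 2 * (v $ i * cnj (v $ j))) * y $ j)"
    using i y householder_carrier[OF v]
    by (simp add: scalar_prod_def row_def lessThan_atLeast0 index_householder[OF v])
  also have "\<dots> = (\<Sum>j<n. (if i = j then y $ j else 0) - 2 * (y $ j * cnj (v $ j)) * v $ i)"
    by (intro sum.cong) (auto simp: algebra_simps)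
  also have "\<dots> = y $ i - 2 * (\<Sum>j<n. y $ j * cnj (v $ j)) * v $ i"
    using i by (simp add: sum_subtractf sum_distrib_left sum_distrib_right mult.assoc)
  finally show "(householder v *\<^sub>v y) $ i = (y - (2 * (y \<bullet>c v)) \<cdot>\<^sub>v v) $ i"
    using i v y by (simp add: scalar_prod_def lessThan_atLeast0)
qed (use householder_carrier[OF v] v in auto)

lemma householder_involution:
  assumes v: "v \<in> carrier_vec n" and unit: "v \<bullet>c v = 1"
  shows "householder v * householder v = 1\<^sub>m n"
proof (rule eq_matI)
  fix i j assume "i < dim_row (1\<^sub>m n :: complex mat)" "j < dim_col (1\<^sub>m n :: complex mat)"
  hence ij: "i < n" "j < n" by auto
  note H = householder_carrier[OF v]
  have norm: "(\<Sum>k<n. v $ k * cnj (v $ k)) = 1"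
    using unit v by (simp add: scalar_prod_def lessThan_atLeast0)
  have "(householder v * householder v) $$ (i, j)
      = (\<Sum>k<n. ((if i = k then 1 else 0) - 2 * (v $ i * cnj (v $ k)))
              * ((if k = j then 1 else 0) - 2 * (v $ k * cnj (v $ j))))"
    using ij H by (simp add: scalar_prod_def row_def col_def lessThan_atLeast0 index_householder[OF v])
  also have "\<dots> = (\<Sum>k<n. (if i = k then (if k = j then 1 else 0) - 2 * (v $ k * cnj (v $ j)) else 0)
        - (if k = j then 2 * (v $ i * cnj (v $ k)) else 0)
        + 4 * (v $ i * cnj (v $ j)) * (v $ k * cnj (v $ k)))"
    by (intro sum.cong) (auto simp: algebra_simps)
  also have "\<dots> = (if i = j then 1 else 0)
        - 2 * (v $ i * cnj (v $ j)) - 2 * (v $ i * cnj (v $ j)) + 4 * (v $ i * cnj (v $ j))"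
    using ij norm by (simp add: sum.distrib sum_subtractf flip: sum_distrib_left)
  also have "\<dots> = (1\<^sub>m n :: complex mat) $$ (i, j)" using ij by simp
  finally show "(householder v * householder v) $$ (i, j) = 1\<^sub>m n $$ (i, j)" .
qed (use householder_carrier[OF v] in auto)

lemma vec_restrict_carrier [simp]: "a \<in> carrier_vec n \<Longrightarrow> vec_restrict S a \<in> carrier_vec n"
  by (simp add: vec_restrict_def)

lemma dim_vec_restrict [simp]: "dim_vec (vec_restrict S a) = dim_vec a"
  by (simp add: vec_restrict_def)

lemma index_vec_restrict [simp]:
  "i < dim_vec a \<Longrightarrow> vec_restrict S a $ i = (if i \<in> S then a $ i else 0)"
  by (simp add: vec_restrict_def)

text \<open>The construction skips the reflection when its direction vanishes. Otherwise the normalised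
  direction is a unit vector, which is what makes the Householder matrix an involution.\<close>

lemma hot_reflection_cases:
  fixes u :: "complex vec"
  assumes u: "u \<in> carrier_vec n"
  obtains "hot_reflection S j \<alpha> u = 1\<^sub>m n"
      "vec_restrict S (u - \<alpha> \<cdot>\<^sub>v unit_vec n j) = 0\<^sub>v n"
  | v where "hot_reflection S j \<alpha> u = householder v" "v \<in> carrier_vec n" "v \<bullet>c v = 1"
      "v = complex_of_real (1 / l2_norm (vec_restrict S (u - \<alpha> \<cdot>\<^sub>v unit_vec n j)))
             \<cdot>\<^sub>v vec_restrict S (u - \<alpha> \<cdot>\<^sub>v unit_vec n j)"
proof -
  define d where "d = vec_restrict S (u - \<alpha> \<cdot>\<^sub>v unit_vec n j)"
  have d: "d \<in> carrier_vec n" using u by (simp add: d_def)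
  have H: "hot_reflection S j \<alpha> u
      = (if d = 0\<^sub>v n then 1\<^sub>m n else householder (complex_of_real (1 / l2_norm d) \<cdot>\<^sub>v d))"
    using u by (auto simp: hot_reflection_def Let_def d_def)
  show ?thesis
  proof (cases "d = 0\<^sub>v n")
    case True thus ?thesis using that(1) H by (simp add: d_def)
  next
    case False
    hence nz: "l2_norm d \<noteq> 0" using l2_norm_zero_iff[OF d] by simp
    let ?v = "complex_of_real (1 / l2_norm d) \<cdot>\<^sub>v d"
    have "?v \<bullet>c ?v = complex_of_real (1 / l2_norm d) * complex_of_real (1 / l2_norm d) * (d \<bullet>c d)"
      using d by (simp add: conjugate_smult_vec)
    also have "\<dots> = 1" using nz by (simp add: power2_eq_square flip: l2_norm_square)
    finally show ?thesis using that(2)[of ?v] H False d by (simp add: d_def)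
  qed
qed

lemma hot_reflection_carrier:
  "u \<in> carrier_vec n \<Longrightarrow> hot_reflection S j \<alpha> u \<in> carrier_mat n n"
  by (erule hot_reflection_cases[of u n S j \<alpha>]) (auto intro: householder_carrier)

lemma mat_adjoint_one [simp]: "mat_adjoint (1\<^sub>m n :: complex mat) = 1\<^sub>m n"
  by (intro eq_matI) (auto simp: index_mat_adjoint[of _ n n])

lemma mat_adjoint_hot_reflection:
  "u \<in> carrier_vec n \<Longrightarrow> mat_adjoint (hot_reflection S j \<alpha> u) = hot_reflection S j \<alpha> u"
  by (erule hot_reflection_cases[of u n S j \<alpha>]) (auto intro: mat_adjoint_householder)

lemma hot_reflection_involution:
  "u \<in> carrier_vec n \<Longrightarrow> hot_reflection S j \<alpha> u * hot_reflection S j \<alpha> u = 1\<^sub>m n"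
  by (erule hot_reflection_cases[of u n S j \<alpha>]) (auto intro: householder_involution)

text \<open>With the convention that division by zero gives zero, the formula for a reflection in an
  unnormalised direction also covers the skipped reflection.\<close>

lemma hot_reflection_mult_vec:
  fixes u y :: "complex vec" and S :: "nat set" and j :: nat and \<alpha> :: complex
  assumes u: "u \<in> carrier_vec n" and y: "y \<in> carrier_vec n"
  defines "d \<equiv> vec_restrict S (u - \<alpha> \<cdot>\<^sub>v unit_vec n j)"
  shows "hot_reflection S j \<alpha> u *\<^sub>v y = y - (2 * (y \<bullet>c d) / (d \<bullet>c d)) \<cdot>\<^sub>v d"
  using u
proof (cases rule: hot_reflection_cases[of u n S j \<alpha>])
  case 1
  show ?thesis using 1 y by (auto simp: d_def)
next
  case (2 v)
  have d: "d \<in> carrier_vec n" using u by (simp add: d_def)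
  have "hot_reflection S j \<alpha> u *\<^sub>v y = y - (2 * (y \<bullet>c v)) \<cdot>\<^sub>v v"
    using 2 y by (simp add: householder_mult_vec)
  also have "(2 * (y \<bullet>c v)) \<cdot>\<^sub>v v = (2 * (y \<bullet>c d) / (d \<bullet>c d)) \<cdot>\<^sub>v d"
    unfolding 2(4) d_def[symmetric] l2_norm_square[symmetric]
    using d y by (simp add: conjugate_smult_vec smult_smult_assoc power2_eq_square)
  finally show ?thesis .
qed

text \<open>The direction of the reflection is supported on \<open>S\<close>, hence orthogonal to \<open>y\<close>. This is why
  a step does not destroy what the earlier steps achieved.\<close>

lemma hot_reflection_fixes:
  assumes u: "u \<in> carrier_vec n" and y: "y \<in> carrier_vec n" and disj: "vec_supp y \<inter> S = {}"
  shows "hot_reflection S j \<alpha> u *\<^sub>v y = y"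
proof -
  have "y \<bullet>c vec_restrict S (u - \<alpha> \<cdot>\<^sub>v unit_vec n j) = 0"
    using u y disj by (auto simp: scalar_prod_def vec_supp_def intro!: sum.neutral)
  thus ?thesis using hot_reflection_mult_vec[OF u y, of S j \<alpha>] u y by auto
qed

text \<open>The direction of the reflection is a combination of \<open>u\<close> and of the \<open>j\<close>-th unit vector, both
  supported on \<open>W\<close>.\<close>

lemma vec_supp_hot_reflection_mult_vec:
  assumes u: "u \<in> carrier_vec n" and y: "y \<in> carrier_vec n"
    and supp: "vec_supp u \<subseteq> W" "vec_supp y \<subseteq> W" and j: "j \<in> W"
  shows "vec_supp (hot_reflection S j \<alpha> u *\<^sub>v y) \<subseteq> W"
proof
  fix i assume i: "i \<in> vec_supp (hot_reflection S j \<alpha> u *\<^sub>v y)"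
  show "i \<in> W"
  proof (rule ccontr)
    assume iW: "i \<notin> W"
    have "i < n"
      using i carrier_matD(1)[OF hot_reflection_carrier[OF u, of S j \<alpha>]] by (simp add: vec_supp_def)
    moreover from this have "u $ i = 0" "y $ i = 0" "i \<noteq> j"
      using iW supp j u y by (auto simp: vec_supp_def)
    ultimately have "(hot_reflection S j \<alpha> u *\<^sub>v y) $ i = 0"
      using u y by (simp add: hot_reflection_mult_vec unit_vec_def)
    thus False using i by (simp add: vec_supp_def)
  qed
qed

text \<open>The classical Householder computation. Let \<open>d\<close> be the direction. The modulus of \<open>\<alpha>\<close> gives
  \<open>\<alpha> * cnj \<alpha> = (u\<^sub>S)\<^sup>H u\<^sub>S\<close>, and the reality condition makes \<open>\<alpha> * cnj (u $ j)\<close> its own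
  conjugate; together they give \<open>d\<^sup>H d = 2 * d\<^sup>H u\<close>, so that the reflection subtracts exactly \<open>d\<close>
  from \<open>u\<close>.\<close>

lemma hot_reflection_maps_reference:
  fixes u :: "complex vec"
  assumes u: "u \<in> carrier_vec n" and j: "j < n" "j \<in> S"
    and cm: "cmod \<alpha> = l2_norm (vec_restrict S u)" and real: "\<alpha> * cnj (u $ j) \<in> \<real>"
    and i: "i < n"
  shows "(hot_reflection S j \<alpha> u *\<^sub>v u) $ i
    = (if i \<in> S then if i = j then \<alpha> else 0 else u $ i)"
proof -
  define d where "d = vec_restrict S (u - \<alpha> \<cdot>\<^sub>v unit_vec n j)"
  have d: "d \<in> carrier_vec n" using u by (simp add: d_def)
  have dnth: "d $ k = (if k \<in> S then u $ k - (if k = j then \<alpha> else 0) else 0)" if "k < n" for k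
    using that u j by (auto simp: d_def)
  define s where "s = (\<Sum>k<n. if k \<in> S then u $ k * cnj (u $ k) else 0)"
  have "complex_of_real ((cmod \<alpha>)\<^sup>2) = s"
    unfolding cm l2_norm_square using u
    by (auto simp: s_def scalar_prod_def lessThan_atLeast0 intro!: sum.cong)
  hence aa: "\<alpha> * cnj \<alpha> = s" by (simp only: complex_norm_square)
  have sym: "\<alpha> * cnj (u $ j) = cnj \<alpha> * u $ j"
    using real Reals_cnj_iff[of "\<alpha> * cnj (u $ j)"] by simp
  have ud: "u \<bullet>c d = s - cnj \<alpha> * u $ j"
  proof -
    have "u \<bullet>c d = (\<Sum>k<n. (if k \<in> S then u $ k * cnj (u $ k) else 0)
        - (if k = j then u $ k * cnj \<alpha> else 0))"
      using u d j by (auto simp: scalar_prod_def lessThan_atLeast0 dnth algebra_simps intro!: sum.cong)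
    thus ?thesis using j by (simp add: sum_subtractf s_def mult.commute)
  qed
  have dd: "d \<bullet>c d = 2 * (u \<bullet>c d)"
  proof -
    have "d \<bullet>c d = (\<Sum>k<n. (if k \<in> S then u $ k * cnj (u $ k) else 0)
        - (if k = j then u $ k * cnj \<alpha> + \<alpha> * cnj (u $ k) - \<alpha> * cnj \<alpha> else 0))"
      using u d j by (auto simp: scalar_prod_def lessThan_atLeast0 dnth algebra_simps intro!: sum.cong)
    also have "\<dots> = s - (u $ j * cnj \<alpha> + \<alpha> * cnj (u $ j) - \<alpha> * cnj \<alpha>)"
      using j by (simp add: sum_subtractf s_def)
    also have "\<dots> = 2 * (u \<bullet>c d)" unfolding aa sym ud by (simp add: mult.commute)
    finally show ?thesis .
  qed
  have "hot_reflection S j \<alpha> u *\<^sub>v u = u - d"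
  proof (cases "d = 0\<^sub>v n")
    case True
    thus ?thesis using hot_reflection_mult_vec[OF u u, of S j \<alpha>] u
      by (auto simp flip: d_def)
  next
    case False
    hence "d \<bullet>c d \<noteq> 0" using d by simp
    hence "2 * (u \<bullet>c d) / (d \<bullet>c d) = 1" using dd by simp
    thus ?thesis using hot_reflection_mult_vec[OF u u, of S j \<alpha>] by (simp flip: d_def)
  qed
  thus ?thesis using i u d dnth[OF i] by auto
qed

section \<open>The posterior domain\<close>

lemma foldl_mult_carrier:
  assumes "D \<in> carrier_mat n n" "\<And>k. k \<in> set ks \<Longrightarrow> H k \<in> carrier_mat n n"
  shows "foldl (*) D (map H ks) \<in> carrier_mat n n"
  using assms by (induction ks arbitrary: D) auto

lemma fold_mult_vec_carrier:
  assumes "y \<in> carrier_vec n" "\<And>k. k \<in> set ks \<Longrightarrow> H k \<in> carrier_mat n n"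
  shows "fold (\<lambda>k y. H k *\<^sub>v y) ks y \<in> carrier_vec n"
  using assms by (induction ks arbitrary: y) (auto intro: mult_mat_vec_carrier)

text \<open>The adjoint reverses the order of the product, and each factor is its own adjoint, so the
  factor that stands first in the product also acts first.\<close>

lemma mat_adjoint_foldl_mult_vec:
  fixes D :: "complex mat"
  assumes "D \<in> carrier_mat n n" "x \<in> carrier_vec n"
    and "\<And>k. k \<in> set ks \<Longrightarrow> H k \<in> carrier_mat n n"
    and "\<And>k. k \<in> set ks \<Longrightarrow> mat_adjoint (H k) = H k"
  shows "mat_adjoint (foldl (*) D (map H ks)) *\<^sub>v x
    = fold (\<lambda>k y. H k *\<^sub>v y) ks (mat_adjoint D *\<^sub>v x)"
  using assms
proof (induction ks arbitrary: D)
  case (Cons k ks)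
  have H: "H k \<in> carrier_mat n n" using Cons.prems by simp
  have "mat_adjoint (D * H k) *\<^sub>v x = H k *\<^sub>v (mat_adjoint D *\<^sub>v x)"
    using Cons.prems H mat_adjoint_carrier[OF Cons.prems(1)]
    by (simp add: mat_adjoint_mult[of D n n _ n] assoc_mult_mat_vec[of _ n n _ n])
  thus ?case using Cons.IH[of "D * H k"] Cons.prems H by simp
qed simp

lemma mat_adjoint_mult_foldl:
  fixes D :: "complex mat"
  assumes "D \<in> carrier_mat n n" "mat_adjoint D * D = 1\<^sub>m n"
    and "\<And>k. k \<in> set ks \<Longrightarrow> H k \<in> carrier_mat n n"
    and "\<And>k. k \<in> set ks \<Longrightarrow> mat_adjoint (H k) = H k"
    and "\<And>k. k \<in> set ks \<Longrightarrow> H k * H k = 1\<^sub>m n"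
  shows "mat_adjoint (foldl (*) D (map H ks)) * foldl (*) D (map H ks) = 1\<^sub>m n"
  using assms
proof (induction ks arbitrary: D)
  case (Cons k ks)
  have H: "H k \<in> carrier_mat n n" "mat_adjoint (H k) = H k" "H k * H k = 1\<^sub>m n"
    using Cons.prems by auto
  note D = Cons.prems(1) mat_adjoint_carrier[OF Cons.prems(1)]
  have "mat_adjoint (D * H k) * (D * H k) = H k * (mat_adjoint D * (D * H k))"
    using D H by (simp add: mat_adjoint_mult[of D n n _ n] assoc_mult_mat[of _ n n _ n _ n])
  also have "mat_adjoint D * (D * H k) = H k"
    using D H Cons.prems(2) by (simp flip: assoc_mult_mat[of _ n n _ n _ n])
  finally show ?case using Cons.IH[of "D * H k"] Cons.prems H by simp
qed simp

text \<open>Names the vectors \<open>u i\<close> from which the reflections are built. Their dimension has to be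
  established along the way, because each of them depends on the earlier reflections.\<close>

lemma hot_posteriorE:
  assumes D: "D \<in> carrier_mat N N" and rs: "set rs \<subseteq> carrier_vec N"
    and post: "hot_posterior N D rs js D'"
  obtains \<alpha> H u where
    "\<And>i. u i = fold (\<lambda>k y. H k *\<^sub>v y) [0..<i] (mat_adjoint D *\<^sub>v (rs ! i))"
    "\<And>i. i < length rs \<Longrightarrow> u i \<in> carrier_vec N"
    "\<And>i. i < length rs \<Longrightarrow>
       H i = hot_reflection ({0..<N} - set (take i js)) (js ! i) (\<alpha> i) (u i)"
    "\<And>i. i < length rs \<Longrightarrow>
       cmod (\<alpha> i) = l2_norm (vec_restrict ({0..<N} - set (take i js)) (u i))"
    "\<And>i. i < length rs \<Longrightarrow> \<alpha> i * cnj (u i $ (js ! i)) \<in> \<real>"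
    "D' = foldl (*) D (map H [0..<length rs])"
proof -
  from post obtain \<alpha> H where len: "length js = length rs" "set js \<subseteq> {0..<N}"
    and steps: "\<forall>i<length rs.
           let u = fold (\<lambda>k y. H k *\<^sub>v y) [0..<i] (mat_adjoint D *\<^sub>v (rs ! i));
               S = {0..<N} - set (take i js)
           in cmod (\<alpha> i) = l2_norm (vec_restrict S u) \<and>
              \<alpha> i * (unit_vec N (js ! i) \<bullet>c u) \<in> \<real> \<and>
              H i = hot_reflection S (js ! i) (\<alpha> i) u"
    and D': "D' = foldl (*) D (map H [0..<length rs])"
    unfolding hot_posterior_def by blast
  define u where "u i = fold (\<lambda>k y. H k *\<^sub>v y) [0..<i] (mat_adjoint D *\<^sub>v (rs ! i))" for i
  have w: "mat_adjoint D *\<^sub>v (rs ! i) \<in> carrier_vec N" if "i < length rs" for i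
    using that rs mat_adjoint_carrier[OF D] nth_mem[OF that] by (intro mult_mat_vec_carrier) auto
  have H: "H i \<in> carrier_mat N N" if "i < length rs" for i
    using that
  proof (induction i rule: less_induct)
    case (less i)
    have "u i \<in> carrier_vec N"
      unfolding u_def using less w by (intro fold_mult_vec_carrier) auto
    moreover have "H i = hot_reflection ({0..<N} - set (take i js)) (js ! i) (\<alpha> i) (u i)"
      using steps less.prems by (simp add: Let_def u_def)
    ultimately show ?case by (simp add: hot_reflection_carrier)
  qed
  have u: "u i \<in> carrier_vec N" if "i < length rs" for i
    unfolding u_def using that w H by (intro fold_mult_vec_carrier) auto
  have "\<alpha> i * cnj (u i $ (js ! i)) \<in> \<real>" if "i < length rs" for i
  proof -
    have "js ! i < N" using that len by (metis atLeastLessThan_iff nth_mem subsetD)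
    hence "unit_vec N (js ! i) \<bullet>c u i = cnj (u i $ (js ! i))"
      using u[OF that] by (simp add: scalar_prod_left_unit)
    moreover have "\<alpha> i * (unit_vec N (js ! i) \<bullet>c u i) \<in> \<real>"
      using steps that by (simp add: Let_def u_def)
    ultimately show ?thesis by simp
  qed
  with that[of u H \<alpha>] u_def u steps D' show ?thesis by (auto simp: Let_def u_def)
qed

text \<open>In \<open>vec_supp_hot_posterior_reference\<close>, the \<open>i\<close>-th reflection confines the image of the
  \<open>i\<close>-th reference vector to the coordinates chosen up to step \<open>i\<close>, and all later reflections
  leave it alone. For \<open>vec_supp_hot_posterior\<close>, the vectors that define the reflections
  themselves stay inside \<open>W\<close>, so every reflection preserves the vectors supported on \<open>W\<close>.\<close>

lemma
  assumes D: "D \<in> carrier_mat N N" and unitary: "mat_adjoint D * D = 1\<^sub>m N"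
    and rs: "set rs \<subseteq> carrier_vec N" and post: "hot_posterior N D rs js D'"
  shows hot_posterior_carrier: "D' \<in> carrier_mat N N"
    and hot_posterior_unitary: "mat_adjoint D' * D' = 1\<^sub>m N"
    and vec_supp_hot_posterior_reference:
      "\<And>i. i < length rs \<Longrightarrow> vec_supp (mat_adjoint D' *\<^sub>v (rs ! i)) \<subseteq> set js"
    and vec_supp_hot_posterior:
      "\<And>W x. (\<And>i. i < length rs \<Longrightarrow> vec_supp (mat_adjoint D *\<^sub>v (rs ! i)) \<subseteq> W) \<Longrightarrow> set js \<subseteq> W \<Longrightarrow>
        x \<in> carrier_vec N \<Longrightarrow> vec_supp (mat_adjoint D *\<^sub>v x) \<subseteq> W \<Longrightarrow>
        vec_supp (mat_adjoint D' *\<^sub>v x) \<subseteq> W"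
proof -
  from D rs post obtain \<alpha> H u where
    u_def: "\<And>i. u i = fold (\<lambda>k y. H k *\<^sub>v y) [0..<i] (mat_adjoint D *\<^sub>v (rs ! i))"
    and u: "\<And>i. i < length rs \<Longrightarrow> u i \<in> carrier_vec N"
    and H: "\<And>i. i < length rs \<Longrightarrow>
       H i = hot_reflection ({0..<N} - set (take i js)) (js ! i) (\<alpha> i) (u i)"
    and mod: "\<And>i. i < length rs \<Longrightarrow>
       cmod (\<alpha> i) = l2_norm (vec_restrict ({0..<N} - set (take i js)) (u i))"
    and real: "\<And>i. i < length rs \<Longrightarrow> \<alpha> i * cnj (u i $ (js ! i)) \<in> \<real>"
    and D': "D' = foldl (*) D (map H [0..<length rs])"
    by (rule hot_posteriorE) blast
  have js: "length js = length rs" "distinct js" "set js \<subseteq> {0..<N}"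
    using post unfolding hot_posterior_def by blast+
  have Hc: "H i \<in> carrier_mat N N" and Ha: "mat_adjoint (H i) = H i"
    and Hi: "H i * H i = 1\<^sub>m N" if "i < length rs" for i
    using H[OF that] u[OF that]
    by (auto simp: hot_reflection_carrier mat_adjoint_hot_reflection hot_reflection_involution)
  show "D' \<in> carrier_mat N N"
    unfolding D' using D Hc by (intro foldl_mult_carrier) auto
  show "mat_adjoint D' * D' = 1\<^sub>m N"
    unfolding D' using D unitary Hc Ha Hi by (intro mat_adjoint_mult_foldl) auto
  have adj: "mat_adjoint D' *\<^sub>v x = fold (\<lambda>k y. H k *\<^sub>v y) [0..<length rs] (mat_adjoint D *\<^sub>v x)"
    if "x \<in> carrier_vec N" for x
    unfolding D' using that D Hc Ha by (intro mat_adjoint_foldl_mult_vec) auto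
  have wc: "mat_adjoint D *\<^sub>v x \<in> carrier_vec N" if "x \<in> carrier_vec N" for x
    using that mat_adjoint_carrier[OF D] by auto
  show "vec_supp (mat_adjoint D' *\<^sub>v (rs ! i)) \<subseteq> set js" if i: "i < length rs" for i
  proof -
    let ?y = "H i *\<^sub>v u i"
    have ji: "js ! i < N" "js ! i \<notin> set (take i js)"
      using i js by (metis atLeastLessThan_iff nth_mem subsetD)
        (use i js in \<open>auto simp: in_set_conv_nth nth_eq_iff_index_eq\<close>)
    have yc: "?y \<in> carrier_vec N" using Hc[OF i] u[OF i] by auto
    have "vec_supp ?y \<subseteq> set (take (Suc i) js)"
    proof
      fix k assume k: "k \<in> vec_supp ?y"
      hence kN: "k < N" using carrier_matD(1)[OF Hc[OF i]] by (simp add: vec_supp_def)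
      have "?y $ k = (if k \<in> {0..<N} - set (take i js) then if k = js ! i then \<alpha> i else 0 else u i $ k)"
        unfolding H[OF i] using u[OF i] ji mod[OF i] real[OF i] kN
        by (intro hot_reflection_maps_reference) auto
      hence "k \<in> set (take i js) \<or> k = js ! i"
        using k kN by (auto simp: vec_supp_def split: if_splits)
      thus "k \<in> set (take (Suc i) js)" using i js by (auto simp: take_Suc_conv_app_nth)
    qed
    moreover have "fold (\<lambda>k y. H k *\<^sub>v y) ks y = y"
      if "vec_supp y \<subseteq> set (take (Suc i) js)" "y \<in> carrier_vec N"
        "\<forall>k\<in>set ks. i < k \<and> k < length rs" for ks y
      using that
    proof (induction ks)
      case (Cons k ks)
      have "set (take (Suc i) js) \<subseteq> set (take k js)"
        using Cons.prems by (intro set_take_subset_set_take) auto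
      hence "H k *\<^sub>v y = y"
        using Cons.prems H u by (auto intro!: hot_reflection_fixes)
      thus ?case using Cons by simp
    qed simp
    ultimately have fixed: "fold (\<lambda>k y. H k *\<^sub>v y) [Suc i..<length rs] ?y = ?y"
      using yc by simp
    have split: "[0..<length rs] = [0..<i] @ [i] @ [Suc i..<length rs]"
      using i upt_add_eq_append[of 0 i "length rs - i"] by (simp add: upt_conv_Cons)
    have "mat_adjoint D' *\<^sub>v (rs ! i) = ?y"
      using adj[of "rs ! i"] subsetD[OF rs nth_mem[OF i]] fixed
      unfolding split by (simp flip: u_def)
    moreover have "set (take (Suc i) js) \<subseteq> set js" by (rule set_take_subset)
    ultimately show ?thesis using \<open>vec_supp ?y \<subseteq> _\<close> by simp
  qed
  show "vec_supp (mat_adjoint D' *\<^sub>v x) \<subseteq> W"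
    if W: "\<And>i. i < length rs \<Longrightarrow> vec_supp (mat_adjoint D *\<^sub>v (rs ! i)) \<subseteq> W" "set js \<subseteq> W"
      and x: "x \<in> carrier_vec N" "vec_supp (mat_adjoint D *\<^sub>v x) \<subseteq> W" for W x
  proof -
    have inv: "vec_supp (fold (\<lambda>k y. H k *\<^sub>v y) [0..<i] y) \<subseteq> W"
      if "i \<le> length rs" "y \<in> carrier_vec N" "vec_supp y \<subseteq> W" for i y
      using that
    proof (induction i arbitrary: y)
      case (Suc i)
      have i: "i < length rs" using Suc by simp
      let ?z = "fold (\<lambda>k y. H k *\<^sub>v y) [0..<i] y"
      have "vec_supp (u i) \<subseteq> W"
        unfolding u_def using Suc.IH[of "mat_adjoint D *\<^sub>v (rs ! i)"] i W(1)
          wc[OF subsetD[OF rs nth_mem[OF i]]] by simp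
      moreover have "vec_supp ?z \<subseteq> W" using Suc by simp
      moreover have "?z \<in> carrier_vec N" using Suc.prems Hc by (intro fold_mult_vec_carrier) auto
      moreover have "js ! i \<in> W" using i js W(2) nth_mem[of i js] by auto
      ultimately have "vec_supp (H i *\<^sub>v ?z) \<subseteq> W"
        unfolding H[OF i] using u[OF i] by (intro vec_supp_hot_reflection_mult_vec)
      thus ?case by simp
    qed simp
    show ?thesis using adj[OF x(1)] inv[OF _ wc[OF x(1)] x(2)] by simp
  qed
qed

section \<open>Projection onto the span of the reference vectors\<close>

text \<open>A kernel vector \<open>c\<close> of the Gram matrix satisfies \<open>(R c)\<^sup>H (R c) = c\<^sup>H (R\<^sup>H R) c = 0\<close>, so \<open>R c = 0\<close>
  would be a linear dependence of the columns.\<close>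

lemma gram_invertible:
  assumes "lin_indpt_vecs N rs" and R: "R = mat_of_cols N rs"
  obtains G where "mat_inverse (mat_adjoint R * R) = Some G"
    "G \<in> carrier_mat (length rs) (length rs)" "G * (mat_adjoint R * R) = 1\<^sub>m (length rs)"
proof -
  let ?K = "length rs"
  have Rc: "R \<in> carrier_mat N ?K" by (simp add: R)
  have rs: "set rs \<subseteq> carrier_vec N" "distinct rs"
    "\<not> module.lin_dep class_ring (module_vec TYPE(complex) N) (set rs)"
    using assms(1) by (auto simp: lin_indpt_vecs_def)
  have cols: "cols R = rs" using rs(1) by (simp add: R)
  note Ra = mat_adjoint_carrier[OF Rc]
  have Gram: "mat_adjoint R * R \<in> carrier_mat ?K ?K" using Ra Rc by simp
  have "det (mat_adjoint R * R) \<noteq> 0"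
  proof
    assume "det (mat_adjoint R * R) = 0"
    then obtain c where c: "c \<in> carrier_vec ?K" "c \<noteq> 0\<^sub>v ?K" "(mat_adjoint R * R) *\<^sub>v c = 0\<^sub>v ?K"
      using det_0_iff_vec_prod_zero[OF Gram] by blast
    have Rcc: "R *\<^sub>v c \<in> carrier_vec N" using Rc c by auto
    have "(R *\<^sub>v c) \<bullet>c (R *\<^sub>v c) = c \<bullet>c (mat_adjoint R *\<^sub>v (R *\<^sub>v c))"
      by (rule cscalar_prod_mat_adjoint[OF Rc c(1) Rcc])
    also have "mat_adjoint R *\<^sub>v (R *\<^sub>v c) = 0\<^sub>v ?K"
      using assoc_mult_mat_vec[OF Ra Rc c(1)] c(3) by simp
    finally have "R *\<^sub>v c = 0\<^sub>v N" using Rcc c by simp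
    hence "module.lin_dep class_ring (module_vec TYPE(complex) N) (set (cols R))"
      using Rc c cols rs(2) by (intro vec_space.lin_depI) auto
    thus False using rs(3) cols by simp
  qed
  hence "mat_adjoint R * R \<in> Units (ring_mat TYPE(complex) ?K ())"
    by (rule det_non_zero_imp_unit[OF Gram])
  then obtain G where "mat_inverse (mat_adjoint R * R) = Some G"
    using mat_inverse(1)[OF Gram] by (metis option.exhaust)
  thus ?thesis using that mat_inverse(2)[OF Gram] by blast
qed

text \<open>If the columns of \<open>B\<close> are orthonormal, the projection onto the column space of \<open>R = B A\<close> is that
  onto the column space of \<open>B\<close>. The Gram matrix of \<open>R\<close> is \<open>A\<^sup>H A\<close>, so its inverse \<open>G\<close>
  exhibits \<open>G A\<^sup>H\<close> as a left inverse of the square matrix \<open>A\<close>; it is then a right inverse too, and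
  \<open>A G A\<^sup>H\<close> cancels.\<close>

lemma column_projection_eq:
  assumes li: "lin_indpt_vecs N rs" and R: "R = mat_of_cols N rs" and K: "length rs = K"
    and B: "B \<in> carrier_mat N K" "mat_adjoint B * B = 1\<^sub>m K"
    and A: "A \<in> carrier_mat K K" and fact: "R = B * A"
  shows "column_projection R = B * mat_adjoint B"
proof -
  from li R obtain G where G: "mat_inverse (mat_adjoint R * R) = Some G"
    "G \<in> carrier_mat K K" "G * (mat_adjoint R * R) = 1\<^sub>m K"
    unfolding K[symmetric] by (rule gram_invertible)
  note Aa = mat_adjoint_carrier[OF A] and Ba = mat_adjoint_carrier[OF B(1)]
  note assoc = assoc_mult_mat[of _ K K _ K _ K] assoc_mult_mat[of _ K K _ N _ K]
    assoc_mult_mat[of _ N K _ K _ K] assoc_mult_mat[of _ N K _ K _ N]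
    assoc_mult_mat[of _ K K _ K _ N] assoc_mult_mat[of _ K N _ K _ K]
  have "mat_adjoint R * R = mat_adjoint A * (mat_adjoint B * (B * A))"
    using A B Aa Ba by (simp add: fact mat_adjoint_mult[OF B(1) A] assoc)
  also have "mat_adjoint B * (B * A) = A"
    using A B Ba by (simp flip: assoc_mult_mat[OF Ba B(1) A])
  finally have "(G * mat_adjoint A) * A = 1\<^sub>m K" using G A Aa by (simp add: assoc)
  hence "A * (G * mat_adjoint A) = 1\<^sub>m K"
    using mat_mult_left_right_inverse[of "G * mat_adjoint A" K A] A Aa G by simp
  moreover have "column_projection R = B * (A * (G * mat_adjoint A)) * mat_adjoint B"
    unfolding column_projection_def G(1) option.sel unfolding fact mat_adjoint_mult[OF B(1) A]
    using A B Aa Ba G by (simp add: assoc)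
  ultimately show ?thesis using B by simp
qed

definition coordinate_embedding :: "nat \<Rightarrow> nat list \<Rightarrow> complex mat" where
  "coordinate_embedding N js = mat_of_cols N (map (unit_vec N) js)"

lemma coordinate_embedding_carrier [simp]:
  "coordinate_embedding N js \<in> carrier_mat N (length js)"
  using mat_of_cols_carrier(1)[of N "map (unit_vec N) js"] by (simp add: coordinate_embedding_def)

lemma index_coordinate_embedding:
  "i < N \<Longrightarrow> k < length js \<Longrightarrow> coordinate_embedding N js $$ (i, k) = (if i = js ! k then 1 else 0)"
  by (simp add: coordinate_embedding_def mat_of_cols_index unit_vec_def)

lemma index_mat_adjoint_coordinate_embedding:
  "i < N \<Longrightarrow> k < length js \<Longrightarrow>
    mat_adjoint (coordinate_embedding N js) $$ (k, i) = (if i = js ! k then 1 else 0)"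
  by (simp add: index_mat_adjoint[OF coordinate_embedding_carrier] index_coordinate_embedding)

lemma coordinate_embedding_isometry:
  assumes "distinct js" "set js \<subseteq> {0..<N}"
  shows "mat_adjoint (coordinate_embedding N js) * coordinate_embedding N js = 1\<^sub>m (length js)"
proof (rule eq_matI)
  let ?E = "coordinate_embedding N js"
  have E: "?E \<in> carrier_mat N (length js)" by simp
  fix k l assume "k < dim_row (1\<^sub>m (length js) :: complex mat)" "l < dim_col (1\<^sub>m (length js) :: complex mat)"
  hence kl: "k < length js" "l < length js" by auto
  hence "js ! k < N" using assms(2) by (metis atLeastLessThan_iff nth_mem subsetD)
  have "(mat_adjoint ?E * ?E) $$ (k, l)
      = (\<Sum>i<N. (if i = js ! k then 1 else 0) * (if i = js ! l then 1 else 0))"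
    using kl carrier_matD[OF E]
    by (simp add: scalar_prod_def row_def col_def lessThan_atLeast0
        index_mat_adjoint_coordinate_embedding index_coordinate_embedding)
  also have "\<dots> = 1\<^sub>m (length js) $$ (k, l)"
    using kl \<open>js ! k < N\<close> assms(1)
    by (simp add: if_distrib[of "\<lambda>c. c * _"] nth_eq_iff_index_eq cong: if_cong)
  finally show "(mat_adjoint ?E * ?E) $$ (k, l) = 1\<^sub>m (length js) $$ (k, l)" .
qed (auto simp: carrier_matD[OF coordinate_embedding_carrier])

lemma mat_adjoint_coordinate_embedding_mult_vec:
  assumes "set js \<subseteq> {0..<N}" "w \<in> carrier_vec N" "k < length js"
  shows "(mat_adjoint (coordinate_embedding N js) *\<^sub>v w) $ k = w $ (js ! k)"
proof -
  let ?E = "coordinate_embedding N js"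
  have E: "?E \<in> carrier_mat N (length js)" by simp
  have "js ! k < N" using assms by (metis atLeastLessThan_iff nth_mem subsetD)
  have "(mat_adjoint ?E *\<^sub>v w) $ k = (\<Sum>i<N. (if i = js ! k then 1 else 0) * w $ i)"
    using assms(2,3) carrier_matD[OF E]
    by (simp add: scalar_prod_def row_def lessThan_atLeast0 index_mat_adjoint_coordinate_embedding)
  thus ?thesis
    using \<open>js ! k < N\<close> by (simp add: if_distrib[of "\<lambda>c. c * _"] cong: if_cong)
qed

lemma coordinate_embedding_adjoint_mult_vec:
  assumes "distinct js" "set js \<subseteq> {0..<N}" "w \<in> carrier_vec N" "vec_supp w \<subseteq> set js"
  shows "coordinate_embedding N js *\<^sub>v (mat_adjoint (coordinate_embedding N js) *\<^sub>v w) = w"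
proof (rule eq_vecI)
  let ?E = "coordinate_embedding N js"
  have E: "?E \<in> carrier_mat N (length js)" by simp
  fix i assume "i < dim_vec w"
  hence i: "i < N" using assms by simp
  have "(?E *\<^sub>v z) $ i = (\<Sum>k<length js. (if i = js ! k then 1 else 0) * z $ k)"
    if "dim_vec z = length js" for z
    using i that carrier_matD[OF E]
    by (simp add: scalar_prod_def row_def lessThan_atLeast0 index_coordinate_embedding)
  hence "(?E *\<^sub>v (mat_adjoint ?E *\<^sub>v w)) $ i
      = (\<Sum>k<length js. (if i = js ! k then 1 else 0) * (mat_adjoint ?E *\<^sub>v w) $ k)"
    using carrier_matD[OF E] by (simp del: index_mult_mat_vec)
  also have "\<dots> = (\<Sum>k<length js. (if i = js ! k then 1 else 0) * w $ (js ! k))"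
    using assms by (simp add: mat_adjoint_coordinate_embedding_mult_vec del: index_mult_mat_vec)
  also have "\<dots> = (\<Sum>j\<in>set js. (if i = j then 1 else 0) * w $ j)"
    using bij_betw_nth[OF assms(1) refl refl] by (rule sum.reindex_bij_betw)
  also have "\<dots> = (if i \<in> set js then w $ i else 0)"
    by (simp add: if_distrib[of "\<lambda>c. c * _"] cong: if_cong)
  also have "\<dots> = w $ i" using assms(3,4) i by (auto simp: vec_supp_def)
  finally show "(?E *\<^sub>v (mat_adjoint ?E *\<^sub>v w)) $ i = w $ i" .
qed (use assms in \<open>auto simp: carrier_matD[OF coordinate_embedding_carrier]\<close>)

lemma l2_norm_mat_adjoint_coordinate_embedding:
  assumes "distinct js" "set js \<subseteq> {0..<N}" "w \<in> carrier_vec N"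
  shows "l2_norm (mat_adjoint (coordinate_embedding N js) *\<^sub>v w)
    = L2_set (\<lambda>j. cmod (w $ j)) (set js)"
proof -
  have "(\<Sum>k<length js. (cmod (w $ (js ! k)))\<^sup>2) = (\<Sum>j\<in>set js. (cmod (w $ j))\<^sup>2)"
    using bij_betw_nth[OF assms(1) refl refl] by (rule sum.reindex_bij_betw)
  thus ?thesis using assms
    by (simp add: l2_norm_def L2_set_def mat_adjoint_coordinate_embedding_mult_vec
        carrier_matD[OF coordinate_embedding_carrier] del: index_mult_mat_vec)
qed

text \<open>Let \<open>E\<close> embed the coordinates \<open>js\<close> into the space. The support condition says that
  \<open>U\<^sup>H R = E A\<close> for the square matrix \<open>A = E\<^sup>H U\<^sup>H R\<close>, i.e. \<open>R = (U E) A\<close> where \<open>U E\<close>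
  has orthonormal columns. The projection of \<open>U w\<close> is therefore \<open>(U E) (E\<^sup>H w)\<close>, whose norm is that
  of the entries of \<open>w\<close> at \<open>js\<close>.\<close>

lemma l2_norm_column_projection:
  assumes li: "lin_indpt_vecs N rs" and R: "R = mat_of_cols N rs"
    and U: "U \<in> carrier_mat N N" "mat_adjoint U * U = 1\<^sub>m N"
    and js: "length js = length rs" "distinct js" "set js \<subseteq> {0..<N}"
    and supp: "\<And>i. i < length rs \<Longrightarrow> vec_supp (mat_adjoint U *\<^sub>v (rs ! i)) \<subseteq> set js"
    and w: "w \<in> carrier_vec N"
  shows "l2_norm (column_projection R *\<^sub>v (U *\<^sub>v w)) = L2_set (\<lambda>j. cmod (w $ j)) (set js)"
proof -
  let ?K = "length rs"
  define E where "E = coordinate_embedding N js"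
  define B where "B = U * E"
  define A where "A = mat_adjoint E * (mat_adjoint U * R)"
  have E: "E \<in> carrier_mat N ?K" and EE: "mat_adjoint E * E = 1\<^sub>m ?K"
    using coordinate_embedding_carrier[of N js] coordinate_embedding_isometry[OF js(2,3)]
    by (simp_all add: E_def js(1))
  have rs: "set rs \<subseteq> carrier_vec N" using li by (simp add: lin_indpt_vecs_def)
  have Rc: "R \<in> carrier_mat N ?K" by (simp add: R)
  note Ua = mat_adjoint_carrier[OF U(1)] and Ea = mat_adjoint_carrier[OF E]
  have UU: "U * mat_adjoint U = 1\<^sub>m N" by (rule mat_mult_left_right_inverse[OF Ua U(1) U(2)])
  have B: "B \<in> carrier_mat N ?K" using U E by (simp add: B_def)
  have Ba: "mat_adjoint B = mat_adjoint E * mat_adjoint U"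
    unfolding B_def by (rule mat_adjoint_mult[OF U(1) E])
  have BUv: "mat_adjoint B *\<^sub>v (U *\<^sub>v v) = mat_adjoint E *\<^sub>v v" if "v \<in> carrier_vec N" for v
  proof -
    have "mat_adjoint B *\<^sub>v (U *\<^sub>v v) = mat_adjoint E *\<^sub>v (mat_adjoint U *\<^sub>v (U *\<^sub>v v))"
      unfolding Ba by (rule assoc_mult_mat_vec[OF Ea Ua mult_mat_vec_carrier[OF U(1) that]])
    also have "mat_adjoint U *\<^sub>v (U *\<^sub>v v) = v"
      using that U by (simp flip: assoc_mult_mat_vec[OF Ua U(1) that])
    finally show ?thesis .
  qed
  have "mat_adjoint B * B = mat_adjoint E * (mat_adjoint U * (U * E))"
    unfolding Ba unfolding B_def
    by (rule assoc_mult_mat[OF Ea Ua mult_carrier_mat[OF U(1) E]])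
  also have "mat_adjoint U * (U * E) = E"
    using U E by (simp flip: assoc_mult_mat[OF Ua U(1) E])
  finally have BB: "mat_adjoint B * B = 1\<^sub>m ?K" using EE by simp
  have Ac: "A \<in> carrier_mat ?K ?K" using Ea Ua Rc by (simp add: A_def)
  have UR: "mat_adjoint U * R \<in> carrier_mat N ?K" using Ua Rc by simp
  have EAU: "E * A = mat_adjoint U * R"
  proof (rule mat_col_eqI)
    fix l assume "l < dim_col (mat_adjoint U * R)"
    hence l: "l < ?K" using Rc by simp
    have rl: "rs ! l \<in> carrier_vec N" using rs nth_mem[OF l] by blast
    have c: "col (mat_adjoint U * R) l = mat_adjoint U *\<^sub>v (rs ! l)"
      unfolding col_mult2[OF Ua Rc l] using l rl by (simp add: R)
    have "col (E * A) l = E *\<^sub>v (mat_adjoint E *\<^sub>v col (mat_adjoint U * R) l)"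
      unfolding col_mult2[OF E Ac l] unfolding A_def col_mult2[OF Ea UR l] ..
    also have "\<dots> = col (mat_adjoint U * R) l"
      unfolding c E_def
      by (rule coordinate_embedding_adjoint_mult_vec[OF js(2,3) mult_mat_vec_carrier[OF Ua rl] supp[OF l]])
    finally show "col (E * A) l = col (mat_adjoint U * R) l" .
  qed (use E Ua Ac Rc in auto)
  have "B * A = U * (E * A)" unfolding B_def by (rule assoc_mult_mat[OF U(1) E Ac])
  also have "\<dots> = R" unfolding EAU using UU Rc by (simp flip: assoc_mult_mat[OF U(1) Ua Rc])
  finally have "column_projection R = B * mat_adjoint B"
    by (intro column_projection_eq[OF li R refl B BB Ac]) simp
  hence "column_projection R *\<^sub>v (U *\<^sub>v w) = B *\<^sub>v (mat_adjoint E *\<^sub>v w)"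
    using BUv[OF w] assoc_mult_mat_vec[OF B mat_adjoint_carrier[OF B] mult_mat_vec_carrier[OF U(1) w]]
    by simp
  hence "l2_norm (column_projection R *\<^sub>v (U *\<^sub>v w)) = l2_norm (mat_adjoint E *\<^sub>v w)"
    using l2_norm_isometry[OF B BB, of "mat_adjoint E *\<^sub>v w"] mult_mat_vec_carrier[OF Ea w] by simp
  thus ?thesis
    unfolding E_def using l2_norm_mat_adjoint_coordinate_embedding[OF js(2,3) w] by simp
qed

section \<open>Representations in the posterior domain\<close>

lemma hot_posterior_indices:
  assumes "hot_posterior N D rs js D'"
  shows "set js \<subseteq> {..<N}" "card (set js) = length rs"
proof -
  have "distinct js" "set js \<subseteq> {0..<N}" "length js = length rs"
    using assms unfolding hot_posterior_def by blast+
  thus "set js \<subseteq> {..<N}" "card (set js) = length rs"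
    by (simp_all add: distinct_card lessThan_atLeast0)
qed

lemma
  assumes D: "D \<in> carrier_mat N N" and unitary: "mat_adjoint D * D = 1\<^sub>m N"
    and li: "lin_indpt_vecs N rs" and post: "hot_posterior N D rs js D'"
    and w: "w \<in> carrier_vec N" and x: "x = D' *\<^sub>v w"
  shows l2_norm_hot_posterior: "l2_norm w = l2_norm x"
    and l2_norm_column_projection_hot_posterior:
      "l2_norm (column_projection (mat_of_cols N rs) *\<^sub>v x) = L2_set (\<lambda>j. cmod (w $ j)) (set js)"
proof -
  have rs: "set rs \<subseteq> carrier_vec N" using li by (simp add: lin_indpt_vecs_def)
  have js: "length js = length rs" "distinct js" "set js \<subseteq> {0..<N}"
    using post unfolding hot_posterior_def by blast+
  note U = hot_posterior_carrier[OF D unitary rs post] hot_posterior_unitary[OF D unitary rs post]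
  show "l2_norm w = l2_norm x" unfolding x l2_norm_isometry[OF U w] ..
  show "l2_norm (column_projection (mat_of_cols N rs) *\<^sub>v x) = L2_set (\<lambda>j. cmod (w $ j)) (set js)"
    unfolding x
    by (rule l2_norm_column_projection[OF li refl U js vec_supp_hot_posterior_reference w])
      (rule D unitary rs post | assumption)+
qed

text \<open>The entry of \<open>D\<^sup>H r\<close> at the index \<open>j\<close> is the inner product of \<open>r\<close> with the \<open>j\<close>-th column
  of \<open>D\<close>. Its being nonzero puts every chosen index into the support of the prior
  representation, so the reflections never leave the coordinates of that support.\<close>

lemma l0_norm_hot_posterior_le:
  assumes D: "D \<in> carrier_mat N N" and unitary: "mat_adjoint D * D = 1\<^sub>m N"
    and rs: "set rs \<subseteq> carrier_vec N" and post: "hot_posterior N D rs js D'"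
    and w: "w \<in> carrier_vec N" and w': "w' \<in> carrier_vec N" and eq: "D *\<^sub>v w = D' *\<^sub>v w'"
    and supp: "\<And>i. i < length rs \<Longrightarrow> vec_supp (mat_adjoint D *\<^sub>v (rs ! i)) \<subseteq> vec_supp w"
    and nonzero: "\<And>i. i < length rs \<Longrightarrow> col D (js ! i) \<bullet>c (rs ! i) \<noteq> 0"
  shows "l0_norm w' \<le> l0_norm w"
proof -
  have js: "length js = length rs" "set js \<subseteq> {0..<N}"
    using post unfolding hot_posterior_def by blast+
  note U = hot_posterior_carrier[OF D unitary rs post] hot_posterior_unitary[OF D unitary rs post]
  have Dw: "mat_adjoint D *\<^sub>v (D *\<^sub>v w) = w"
    using assoc_mult_mat_vec[OF mat_adjoint_carrier[OF D] D w] unitary w by simp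
  have Uw: "mat_adjoint D' *\<^sub>v (D *\<^sub>v w) = w'"
    unfolding eq using assoc_mult_mat_vec[OF mat_adjoint_carrier[OF U(1)] U(1) w'] U(2) w' by simp
  have "js ! i \<in> vec_supp w" if i: "i < length rs" for i
  proof -
    have ji: "js ! i < N" using i js by (metis atLeastLessThan_iff nth_mem subsetD)
    have r: "rs ! i \<in> carrier_vec N" using rs i nth_mem by blast
    have "(mat_adjoint D *\<^sub>v (rs ! i)) $ (js ! i) = conjugate (col D (js ! i)) \<bullet> (rs ! i)"
      using ji D by (simp add: mat_adjoint_def)
    also have "\<dots> = conjugate (col D (js ! i) \<bullet>c (rs ! i))"
      using conjugate_sprod_vec[OF col_carrier_vec[OF ji D] carrier_vec_conjugate[OF r]] by simp
    also have "\<dots> \<noteq> 0" using nonzero[OF i] by simp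
    finally have "js ! i \<in> vec_supp (mat_adjoint D *\<^sub>v (rs ! i))"
      using ji D by (simp add: vec_supp_def)
    thus ?thesis using supp[OF i] by blast
  qed
  hence "set js \<subseteq> vec_supp w" using js(1) by (auto simp: in_set_conv_nth)
  hence "vec_supp w' \<subseteq> vec_supp w"
    using vec_supp_hot_posterior[OF D unitary rs post supp, of "D *\<^sub>v w"] D w by (simp add: Dw Uw)
  thus ?thesis unfolding l0_norm_def by (intro card_mono) (auto simp: vec_supp_def)
qed

section \<open>Energy on a coordinate set\<close>

text \<open>Listing \<open>J\<close> in increasing order, its \<open>i\<close>-th element is at least \<open>i\<close>, so the entry there is at most
  the \<open>i\<close>-th entry of the descending list.\<close>

lemma sum_nth_le_sum_initial:
  fixes xs :: "real list"
  assumes sorted: "sorted_wrt (\<ge>) xs" and J: "J \<subseteq> {..<length xs}"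
  shows "(\<Sum>j\<in>J. xs ! j) \<le> (\<Sum>i<card J. xs ! i)"
proof -
  have fin: "finite J" using J finite_subset by blast
  define es where "es = sorted_list_of_set J"
  have es: "sorted es" "distinct es" "set es = J" "length es = card J"
    using fin by (auto simp: es_def)
  have ge: "i \<le> es ! i" if "i < length es" for i
    using that
  proof (induction i)
    case (Suc i)
    have "es ! i < es ! Suc i"
      using es Suc.prems strict_sorted_iff[of es] sorted_wrt_nth_less[of "(<)" es i "Suc i"] by auto
    thus ?case using Suc by simp
  qed simp
  have "(\<Sum>j\<in>J. xs ! j) = (\<Sum>i<card J. xs ! (es ! i))"
    using es by (metis bij_betw_nth sum.reindex_bij_betw)
  also have "\<dots> \<le> (\<Sum>i<card J. xs ! i)"
  proof (rule sum_mono)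
    fix i assume "i \<in> {..<card J}"
    hence i: "i < length es" using es by simp
    hence "es ! i < length xs" using J es nth_mem by blast
    thus "xs ! (es ! i) \<le> xs ! i"
      using sorted ge[OF i] sorted_wrt_nth_less[of "(\<ge>)" xs i "es ! i"]
      by (cases "i = es ! i") auto
  qed
  finally show ?thesis .
qed

text \<open>Sorting is a permutation \<open>p\<close> of the positions, which carries \<open>J\<close> to a set of the same size in
  the descending list of squared magnitudes.\<close>

lemma energy_le_energy_concentration:
  assumes J: "J \<subseteq> {..<dim_vec a}"
  shows "(\<Sum>j\<in>J. (cmod (a $ j))\<^sup>2) \<le> (\<Sum>i<card J. (magnitudes_desc a ! i)\<^sup>2)"
proof -
  define ys where "ys = map (\<lambda>c. (cmod c)\<^sup>2) (list_of_vec a)"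
  define xs where "xs = map (\<lambda>r. r\<^sup>2) (magnitudes_desc a)"
  have len: "length (magnitudes_desc a) = dim_vec a" "length ys = dim_vec a" "length xs = dim_vec a"
    by (simp_all add: magnitudes_desc_def ys_def xs_def)
  have "mset ys = mset xs"
    by (simp add: ys_def xs_def magnitudes_desc_def multiset.map_comp o_def)
  then obtain p where p: "p permutes {..<length xs}" "permute_list p xs = ys"
    using mset_eq_permutation by blast
  have nth: "ys ! i = xs ! p i" if "i < dim_vec a" for i
    using p len that permute_list_nth[OF p(1)] by metis
  have ys: "ys ! i = (cmod (a $ i))\<^sup>2" if "i < dim_vec a" for i
    using that by (simp add: ys_def list_of_vec_index)
  have "sorted_wrt (\<ge>) (magnitudes_desc a)"
    unfolding magnitudes_desc_def sorted_wrt_rev by simp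
  moreover have "0 \<le> r" if "r \<in> set (magnitudes_desc a)" for r
    using that by (auto simp: magnitudes_desc_def)
  ultimately have sorted: "sorted_wrt (\<ge>) xs"
    unfolding xs_def sorted_wrt_map by (auto intro: power_mono elim!: sorted_wrt_mono_rel[rotated])
  have inj: "inj_on p J" using p(1) by (meson permutes_inj_on)
  have "(\<Sum>j\<in>J. (cmod (a $ j))\<^sup>2) = (\<Sum>j\<in>J. xs ! p j)"
    using J nth ys by (intro sum.cong) auto
  also have "\<dots> = (\<Sum>j\<in>p ` J. xs ! j)" using inj by (simp add: sum.reindex)
  also have "\<dots> \<le> (\<Sum>i<card (p ` J). xs ! i)"
    using J p len permutes_in_image[OF p(1)] by (intro sum_nth_le_sum_initial sorted) auto
  also have "\<dots> = (\<Sum>i<card J. (magnitudes_desc a ! i)\<^sup>2)"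
    using inj card_mono[OF _ J] len by (intro sum.cong) (auto simp: card_image xs_def)
  finally show ?thesis .
qed

lemma energy_share_le_energy_concentration:
  assumes "J \<subseteq> {..<dim_vec a}"
  shows "(L2_set (\<lambda>j. cmod (a $ j)) J / l2_norm a)\<^sup>2 \<le> energy_concentration (card J) a"
  using energy_le_energy_concentration[OF assms]
  by (simp add: power_divide energy_concentration_def L2_set_def sum_nonneg divide_right_mono)

lemma sum_le_sum_L2_set:
  fixes f :: "'a \<Rightarrow> real"
  assumes "\<And>i. i \<in> A \<Longrightarrow> 0 \<le> f i"
  shows "sum f A \<le> sqrt (real (card A)) * L2_set f A"
proof -
  have "sum f A = (\<Sum>i\<in>A. \<bar>1\<bar> * \<bar>f i\<bar>)" using assms by simp
  also have "\<dots> \<le> L2_set (\<lambda>i. 1) A * L2_set f A" by (rule L2_set_mult_ineq)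
  finally show ?thesis by (simp add: L2_set_def)
qed

lemma l1_norm_le_split:
  assumes w: "w \<in> carrier_vec N" and J: "J \<subseteq> {..<N}"
  shows "l1_norm w \<le> sqrt (real (card J)) * L2_set (\<lambda>j. cmod (w $ j)) J
    + sqrt (real N - real (card J)) * L2_set (\<lambda>j. cmod (w $ j)) ({..<N} - J)"
proof -
  have fin: "finite J" using J finite_subset by blast
  have "l1_norm w = (\<Sum>j\<in>J. cmod (w $ j)) + (\<Sum>j\<in>{..<N} - J. cmod (w $ j))"
    using w sum.subset_diff[OF J, of "\<lambda>j. cmod (w $ j)"] by (simp add: l1_norm_def)
  moreover have "real (card ({..<N} - J)) = real N - real (card J)"
    using card_Diff_subset[OF fin J] card_mono[OF _ J] by (simp add: of_nat_diff)
  ultimately show ?thesis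
    using sum_le_sum_L2_set[of J "\<lambda>j. cmod (w $ j)"]
      sum_le_sum_L2_set[of "{..<N} - J" "\<lambda>j. cmod (w $ j)"] by simp
qed

text \<open>The energies on \<open>J\<close> and off \<open>J\<close> add up to the whole, which determines the second from the
  first.\<close>

lemma l1_norm_le_energy_share:
  assumes w: "w \<in> carrier_vec N" "l2_norm w > 0" and J: "J \<subseteq> {..<N}"
  defines "\<rho> \<equiv> L2_set (\<lambda>j. cmod (w $ j)) J / l2_norm w"
  shows "\<rho> \<le> 1"
    and "l1_norm w \<le> (sqrt (real (card J)) * \<rho> + sqrt (real N - real (card J)) * sqrt (1 - \<rho>\<^sup>2))
      * l2_norm w"
proof -
  define p q where "p = L2_set (\<lambda>j. cmod (w $ j)) J"
    and "q = L2_set (\<lambda>j. cmod (w $ j)) ({..<N} - J)"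
  have pq: "p\<^sup>2 + q\<^sup>2 = (l2_norm w)\<^sup>2" and nonneg: "0 \<le> p" "0 \<le> q"
    using w(1) sum.subset_diff[OF J, of "\<lambda>j. (cmod (w $ j))\<^sup>2"]
    by (simp_all add: L2_set_def p_def q_def l2_norm_def sum_nonneg)
  have p: "p = \<rho> * l2_norm w" using w by (simp add: p_def \<rho>_def)
  have "p\<^sup>2 \<le> (l2_norm w)\<^sup>2" using pq zero_le_power2[of q] by linarith
  hence "p \<le> l2_norm w" by (rule power2_le_imp_le) simp
  thus "\<rho> \<le> 1" using w by (simp add: \<rho>_def p_def)
  have "q\<^sup>2 = (1 - \<rho>\<^sup>2) * (l2_norm w)\<^sup>2"
    using pq unfolding p by (simp add: power_mult_distrib left_diff_distrib)
  hence "q = sqrt (1 - \<rho>\<^sup>2) * l2_norm w"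
    using nonneg(2) by (metis l2_norm_nonneg real_sqrt_mult real_sqrt_unique)
  thus "l1_norm w \<le> (sqrt (real (card J)) * \<rho> + sqrt (real N - real (card J)) * sqrt (1 - \<rho>\<^sup>2))
      * l2_norm w"
    using l1_norm_le_split[OF w(1) J] p by (simp add: p_def q_def algebra_simps)
qed

section \<open>The norm trade-off\<close>

text \<open>Geometrically, \<open>(a, b) = (sqrt K, sqrt (N - K))\<close> has length \<open>sqrt N\<close>, and
  \<open>(r, s) = (r, sqrt (1 - r\<^sup>2))\<close> is a unit vector in the first quadrant.
  With \<open>\<phi>\<close> the angle of \<open>(a, b)\<close>, \<open>\<theta>\<close> that of \<open>(r, s)\<close> and \<open>\<psi> = arccos (t / sqrt N)\<close>, the
  conclusion says \<open>\<bar>\<theta> - \<phi>\<bar> \<ge> \<psi>\<close>, and the two thresholds for \<open>r\<close> are \<open>cos (\<phi> - \<psi>)\<close> and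
  \<open>cos (\<phi> + \<psi>)\<close>. The hypothesis \<open>a \<le> t\<close> means \<open>\<psi> \<le> \<phi>\<close>; without it the first threshold would
  refer to an angle outside the quadrant. The proof is the algebraic form of this argument, in the
  coordinates \<open>p\<close>, \<open>m\<close> of \<open>(r, s)\<close> along and across \<open>(a, b)\<close>, scaled by \<open>sqrt N\<close>.\<close>

lemma inner_unit_le_if_outside_thresholds:
  fixes K N t r :: real
  assumes K: "0 \<le> K" "K \<le> N" "0 < N" and t: "sqrt K \<le> t" "t \<le> sqrt N" and r: "0 \<le> r" "r \<le> 1"
    and outside: "r \<ge> (sqrt K * t + sqrt ((N - K) * (N - t\<^sup>2))) / N \<or>
      r \<le> (sqrt K * t - sqrt ((N - K) * (N - t\<^sup>2))) / N"
  shows "sqrt K * r + sqrt (N - K) * sqrt (1 - r\<^sup>2) \<le> t"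
proof (rule ccontr)
  define a b s where "a = sqrt K" and "b = sqrt (N - K)" and "s = sqrt (1 - r\<^sup>2)"
  define p m q where "p = a * r + b * s" and "m = b * r - a * s" and "q = sqrt (N - t\<^sup>2)"
  assume "\<not> ?thesis"
  hence pt: "t < p" by (simp add: p_def a_def b_def s_def)
  have "r\<^sup>2 \<le> 1" using power_mono[OF r(2,1), of 2] by simp
  hence s: "0 \<le> s" and rs: "r\<^sup>2 + s\<^sup>2 = 1" by (auto simp: s_def)
  have a: "0 \<le> a" and b: "0 \<le> b" and n: "a\<^sup>2 + b\<^sup>2 = N" using K by (auto simp: a_def b_def)
  have at: "a \<le> t" using t by (simp add: a_def)
  have t0: "0 \<le> t" using a at by linarith
  have "t\<^sup>2 \<le> N" using power_mono[OF t(2) t0, of 2] K by simp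
  hence q: "0 \<le> q" "t\<^sup>2 + q\<^sup>2 = N" by (auto simp: q_def)
  have "p\<^sup>2 + m\<^sup>2 = (a\<^sup>2 + b\<^sup>2) * (r\<^sup>2 + s\<^sup>2)"
    by (simp add: p_def m_def power2_eq_square algebra_simps)
  hence pm: "p\<^sup>2 + m\<^sup>2 = N" using n rs by simp
  have nr: "N * r = a * p + b * m" and ns: "N * s = b * p - a * m"
    using n by (simp_all add: p_def m_def power2_eq_square algebra_simps flip: n)
  have "t\<^sup>2 < p\<^sup>2" using pt t0 by (intro power_strict_mono) auto
  hence "m\<^sup>2 < q\<^sup>2" using pm q by linarith
  hence "\<bar>m\<bar> < q" using q power2_less_imp_less[of "\<bar>m\<bar>" q] by simp
  hence mq: "m < q" "- q < m" by auto
  \<comment> \<open>\<open>b = 0\<close> would make \<open>a\<close> the full length \<open>sqrt N\<close>, which bounds \<open>p\<close>, against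
    \<open>a \<le> t < p\<close>.\<close>
  have b0: "0 < b"
  proof (rule ccontr)
    assume "\<not> 0 < b"
    hence "a\<^sup>2 = N" using b n by auto
    moreover have "p\<^sup>2 \<le> N" using pm zero_le_power2[of m] by linarith
    moreover have "a\<^sup>2 < p\<^sup>2" using pt at a by (intro power_strict_mono) auto
    ultimately show False by linarith
  qed
  from outside[unfolded real_sqrt_mult] consider "a * t + b * q \<le> N * r" | "N * r \<le> a * t - b * q"
    using K by (auto simp: q_def a_def b_def pos_divide_le_eq pos_le_divide_eq mult.commute)
  thus False
  proof cases
    case 1
    hence le: "b * (q - m) \<le> a * (p - t)" by (simp add: nr algebra_simps)
    \<comment> \<open>Both \<open>(p, m)\<close> and \<open>(t, q)\<close> lie on the circle of radius \<open>sqrt N\<close>.\<close>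
    have eq: "(p - t) * (p + t) = (q - m) * (q + m)"
      using pm q by (simp add: power2_eq_square algebra_simps)
    have "b * (q - m) * (p + t) \<le> a * (p - t) * (p + t)"
      using le pt t0 by (intro mult_right_mono) auto
    also have "\<dots> = (q - m) * (a * (q + m))" using eq by (simp add: ac_simps)
    finally have "(q - m) * (b * (p + t)) \<le> (q - m) * (a * (q + m))" by (simp add: ac_simps)
    hence "b * (p + t) \<le> a * (q + m)" using mq by simp
    \<comment> \<open>The equation for \<open>N * s\<close> rewrites \<open>b * p - a * m\<close>. Since \<open>a \<le> t\<close> forces \<open>a * q \<le> b * t\<close>,
      only \<open>s = 0\<close> is left, where \<open>p = a\<close> is not above \<open>t\<close>.\<close>
    hence 2: "N * s + b * t \<le> a * q" by (simp add: ns algebra_simps)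
    have "a\<^sup>2 \<le> t\<^sup>2" using at a by (intro power_mono) auto
    hence "q\<^sup>2 \<le> b\<^sup>2" using q n by linarith
    hence "q \<le> b" using b by (rule power2_le_imp_le)
    hence "a * q \<le> b * t" using mult_mono[of a t q b] at a q t0 by (simp add: ac_simps)
    hence "N * s \<le> 0" using 2 by linarith
    hence "s = 0" using K s by (simp add: mult_le_0_iff)
    hence "p = a" using rs r by (simp add: p_def power2_eq_1_iff)
    thus False using pt at by simp
  next
    case 2
    hence "b * (q + m) \<le> a * (t - p)" by (simp add: nr algebra_simps)
    also have "\<dots> \<le> 0" using a pt by (simp add: mult_le_0_iff)
    finally show False using b0 mq by (simp add: mult_le_0_iff)
  qed
qed

section \<open>Concentration, sparsity and absolute norm in the posterior domain\<close>

theorem theorem7: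
  fixes N K :: nat
    and Dprior Dpost R :: "complex mat"
    and rs :: "complex vec list"
    and js :: "nat list"
    and x wprior wpost :: "complex vec"
    and \<rho> od :: real
  assumes "Dprior \<in> carrier_mat N N"
    and "mat_adjoint Dprior * Dprior = 1\<^sub>m N"
    and "length rs = K"
    and "lin_indpt_vecs N rs"
    and "R = mat_of_cols N rs"
    and "hot_posterior N Dprior rs js Dpost"
    and "x \<in> carrier_vec N"
    and "x \<noteq> 0\<^sub>v N"
    and "wprior \<in> carrier_vec N"
    and "wpost \<in> carrier_vec N"
    and "x = Dprior *\<^sub>v wprior"
    and "x = Dpost *\<^sub>v wpost"
    and "\<rho> = l2_norm (column_projection R *\<^sub>v x) / l2_norm x"
    and "od = l1_norm wprior / l2_norm wprior"
  shows "0 \<le> \<rho> \<and> \<rho> \<le> 1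
    \<and> (\<rho> \<ge> sqrt (energy_concentration K wprior) \<longrightarrow>
         energy_concentration K wpost \<ge> energy_concentration K wprior)
    \<and> ((\<forall>i<K. vec_supp (mat_adjoint Dprior *\<^sub>v (rs ! i)) \<subseteq> vec_supp wprior \<and>
               col Dprior (js ! i) \<bullet>c (rs ! i) \<noteq> 0) \<longrightarrow>
         l0_norm wpost \<le> l0_norm wprior)
    \<and> (l0_norm wprior \<ge> K \<and> sqrt (real K) \<le> od \<and> od \<le> sqrt (real N) \<longrightarrow>
         (sqrt (real K) \<le> od \<and> od \<le> sqrt (real N - real K) \<and>
          \<rho> \<ge> (sqrt (real K) * od + sqrt ((real N - real K) * (real N - od\<^sup>2))) / real N \<longrightarrow>
            l1_norm wpost \<le> l1_norm wprior)
       \<and> (sqrt (real N - real K) \<le> od \<and> od \<le> sqrt (real N) \<and>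
          (\<rho> \<ge> (sqrt (real K) * od + sqrt ((real N - real K) * (real N - od\<^sup>2))) / real N \<or>
           \<rho> \<le> (sqrt (real K) * od - sqrt ((real N - real K) * (real N - od\<^sup>2))) / real N) \<longrightarrow>
            l1_norm wpost \<le> l1_norm wprior))"
proof -
  note D = assms(1,2) and li = assms(4) and post = assms(6) and wprior = assms(9) and wpost = assms(10)
  have rs: "set rs \<subseteq> carrier_vec N" using li by (simp add: lin_indpt_vecs_def)
  have J: "set js \<subseteq> {..<N}" "card (set js) = K"
    using hot_posterior_indices[OF post] assms(3) by simp_all
  have norms: "l2_norm wprior = l2_norm x" "l2_norm wpost = l2_norm x"
    using l2_norm_isometry[OF D wprior] l2_norm_hot_posterior[OF D li post wpost assms(12)]
    unfolding assms(11) by simp_all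
  have pos: "0 < l2_norm x"
    using l2_norm_zero_iff[OF assms(7)] assms(8) l2_norm_nonneg[of x] by linarith
  have \<rho>: "\<rho> = L2_set (\<lambda>j. cmod (wpost $ j)) (set js) / l2_norm wpost"
    unfolding assms(13,5) l2_norm_column_projection_hot_posterior[OF D li post wpost assms(12)] norms ..
  note share = l1_norm_le_energy_share[OF wpost _ J(1), folded \<rho>, unfolded norms J, OF pos]
  have range: "0 \<le> \<rho>" "\<rho> \<le> 1" by (simp add: \<rho>, rule share(1))

  have a: "energy_concentration K wprior \<le> energy_concentration K wpost"
    if "sqrt (energy_concentration K wprior) \<le> \<rho>"
    using sqrt_le_D[OF that] energy_share_le_energy_concentration[of "set js" wpost, folded \<rho>] J wpost
    by simp

  have b: "l0_norm wpost \<le> l0_norm wprior"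
    if "\<forall>i<K. vec_supp (mat_adjoint Dprior *\<^sub>v (rs ! i)) \<subseteq> vec_supp wprior \<and>
               col Dprior (js ! i) \<bullet>c (rs ! i) \<noteq> 0"
    by (rule l0_norm_hot_posterior_le[OF D rs post wprior wpost assms(11)[symmetric, unfolded assms(12)]])
      (simp_all add: that assms(3))

  have c: "l1_norm wpost \<le> l1_norm wprior"
    if "sqrt (real K) \<le> od" "od \<le> sqrt (real N)"
      "\<rho> \<ge> (sqrt (real K) * od + sqrt ((real N - real K) * (real N - od\<^sup>2))) / real N \<or>
       \<rho> \<le> (sqrt (real K) * od - sqrt ((real N - real K) * (real N - od\<^sup>2))) / real N"
  proof -
    have "N \<noteq> 0"
    proof
      assume "N = 0"
      hence "l2_norm x = 0" using assms(7) by (simp add: l2_norm_def)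
      thus False using pos by simp
    qed
    moreover have "K \<le> N" using J card_mono[of "{..<N}" "set js"] by simp
    ultimately have "sqrt (real K) * \<rho> + sqrt (real N - real K) * sqrt (1 - \<rho>\<^sup>2) \<le> od"
      by (intro inner_unit_le_if_outside_thresholds[OF _ _ _ that(1,2) range that(3)]) simp_all
    hence "l1_norm wpost \<le> od * l2_norm x"
      using share(2) mult_right_mono pos by (meson less_imp_le order_trans)
    thus ?thesis using pos norms assms(14) by simp
  qed

  show ?thesis using range a b c by blast
qed

end
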